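(* Let $J:\mathbf{M}\to\overline{\mathbf{M}}$ be a homothetic map with constant dilation factor $c\notin\{0,1\}$ between smooth surfaces in $\mathbb{E}^3$, let $\varphi(u,v)$ be a surface patch of $\mathbf{M}$, and let $\alpha(s)=\varphi(u(s),v(s))$ be a unit speed rectifying curve on $\mathbf{M}$. Then the component of $\alpha$ along the surface normal is homothetic invariant, i.e. there is a constant $k\notin\{0,1\}$ such that $\overline{\alpha}\cdot\overline{\mathbf{N}}=k^2\,(\alpha\cdot\mathbf{N})$ along the curve.
   Context: Primes denote $d/ds$; subscripts $u,v$ denote partial derivatives. $\vec t,\vec n,\vec b$ are the unit tangent, principal normal and binormal of a space curve (with nonzero curvature $\kappa$). A curve $\alpha$ in $\mathbb{E}^3$ is a rectifying curve if $\alpha\cdot\vec n=0$, i.e. $\alpha=\xi\vec t+\mu\vec b$ for some smooth functions $\xi,\mu$; for a unit speed curve this reads $\alpha=\xi\alpha'+\frac{\mu}{\kappa}\,\alpha'\times\alpha''$. A homothetic map with dilation factor $c$ is a diffeomorphism $J$ for which the first fundamental form coefficients of $\varphi$ and $\overline{\varphi}=J\circ\varphi$ satisfy $\overline{E}=c^2E$, $\overline{F}=c^2F$, $\overline{G}=c^2G$ with $c$ constant. A quantity $f$ on $\mathbf M$ with counterpart $\overline f$ on $\overline{\mathbf M}$ is called homothetic invariant if $\overline f=k^2f$ for some constant $k\notin\{0,1\}$. Objects on $\overline{\mathbf{M}}$ carry a bar, and $\overline{\alpha}=J\circ\alpha$, i.e. $\overline\alpha(s)=\overline\varphi(u(s),v(s))$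 with the same parameter $s$. The surface normals here are $\mathbf{N}=\varphi_u\times\varphi_v$ and $\overline{\mathbf{N}}=\overline{\varphi}_u\times\overline{\varphi}_v$. Standing assumption: $\overline{\alpha}$ is a rectifying curve on $\overline{\mathbf M}$ with the same coefficient functions, $\overline\xi=\xi$ and $\overline\mu/\overline\kappa=\mu/\kappa$, in the sense that $\overline{\alpha}=\xi\,\overline{\alpha}'+\frac{\mu}{\kappa}\,\overline{\alpha}'\times\overline{\alpha}''$ (derivatives with respect to $s$). *)

theory Defs
  imports "HOL-Analysis.Analysis"
begin

text \<open>
  On an open set \<open>S\<close>, \<open>Ck_on k f S\<close> is the usual notion of a \<open>k\<close> times continuously
  differentiable map: the domain is finite-dimensional, so continuity of the derivative is
  equivalent to continuity of all directional derivatives.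
\<close>

primrec Ck_on ::
    "nat \<Rightarrow> ('a::euclidean_space \<Rightarrow> 'b::real_normed_vector) \<Rightarrow> 'a set \<Rightarrow> bool" where
  "Ck_on 0 f S \<longleftrightarrow> continuous_on S f"
| "Ck_on (Suc k) f S \<longleftrightarrow>
     (\<forall>x\<in>S. f differentiable (at x)) \<and>
     (\<forall>w. Ck_on k (\<lambda>x. frechet_derivative f (at x) w) S)"

definition smooth_on ::
    "'a::euclidean_space set \<Rightarrow> ('a \<Rightarrow> 'b::real_normed_vector) \<Rightarrow> bool" where
  "smooth_on S f \<longleftrightarrow> (\<forall>k. Ck_on k f S)"


subsection \<open>Space curves\<close>

abbreviation velocity :: "(real \<Rightarrow> real^3) \<Rightarrow> real \<Rightarrow> real^3" where
  "velocity \<alpha> s \<equiv> vector_derivative \<alpha> (at s)"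

abbreviation acceleration :: "(real \<Rightarrow> real^3) \<Rightarrow> real \<Rightarrow> real^3" where
  "acceleration \<alpha> s \<equiv> vector_derivative (velocity \<alpha>) (at s)"

text \<open>The Frenet apparatus is set up for regular curves of arbitrary speed.\<close>

definition unit_tangent :: "(real \<Rightarrow> real^3) \<Rightarrow> real \<Rightarrow> real^3" where
  "unit_tangent \<alpha> s = velocity \<alpha> s /\<^sub>R norm (velocity \<alpha> s)"

definition curvature :: "(real \<Rightarrow> real^3) \<Rightarrow> real \<Rightarrow> real" where
  "curvature \<alpha> s = norm (vector_derivative (unit_tangent \<alpha>) (at s)) / norm (velocity \<alpha> s)"

definition principal_normal :: "(real \<Rightarrow> real^3) \<Rightarrow> real \<Rightarrow> real^3" where
  "principal_normal \<alpha> s =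
     vector_derivative (unit_tangent \<alpha>) (at s)
       /\<^sub>R norm (vector_derivative (unit_tangent \<alpha>) (at s))"

definition binormal :: "(real \<Rightarrow> real^3) \<Rightarrow> real \<Rightarrow> real^3" where
  "binormal \<alpha> s = cross3 (unit_tangent \<alpha> s) (principal_normal \<alpha> s)"

definition unit_speed :: "real set \<Rightarrow> (real \<Rightarrow> real^3) \<Rightarrow> bool" where
  "unit_speed I \<alpha> \<longleftrightarrow> (\<forall>s\<in>I. norm (velocity \<alpha> s) = 1)"

definition rectifying_curve :: "real set \<Rightarrow> (real \<Rightarrow> real^3) \<Rightarrow> bool" where
  "rectifying_curve I \<alpha> \<longleftrightarrow>
     smooth_on I \<alpha> \<and>
     (\<forall>s\<in>I. velocity \<alpha> s \<noteq> 0 \<and> curvature \<alpha> s \<noteq> 0 \<and> \<alpha> s \<bullet> principal_normal \<alpha> s = 0)"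

definition rectifying_coefficients ::
    "real set \<Rightarrow> (real \<Rightarrow> real^3) \<Rightarrow> (real \<Rightarrow> real) \<Rightarrow> (real \<Rightarrow> real) \<Rightarrow> bool" where
  "rectifying_coefficients I \<alpha> \<xi> \<mu> \<longleftrightarrow>
     smooth_on I \<xi> \<and> smooth_on I \<mu> \<and>
     (\<forall>s\<in>I. \<alpha> s = \<xi> s *\<^sub>R unit_tangent \<alpha> s + \<mu> s *\<^sub>R binormal \<alpha> s)"


subsection \<open>Surfaces in Euclidean space\<close>

definition partial_u :: "(real \<times> real \<Rightarrow> real^3) \<Rightarrow> real \<times> real \<Rightarrow> real^3" where
  "partial_u \<phi> p = vector_derivative (\<lambda>t. \<phi> (t, snd p)) (at (fst p))"

definition partial_v :: "(real \<times> real \<Rightarrow> real^3) \<Rightarrow> real \<times> real \<Rightarrow> real^3" where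
  "partial_v \<phi> p = vector_derivative (\<lambda>t. \<phi> (fst p, t)) (at (snd p))"

text \<open>The surface normal is deliberately not normalised.\<close>

definition surface_normal :: "(real \<times> real \<Rightarrow> real^3) \<Rightarrow> real \<times> real \<Rightarrow> real^3" where
  "surface_normal \<phi> p = cross3 (partial_u \<phi> p) (partial_v \<phi> p)"

definition fundamental_E :: "(real \<times> real \<Rightarrow> real^3) \<Rightarrow> real \<times> real \<Rightarrow> real" where
  "fundamental_E \<phi> p = partial_u \<phi> p \<bullet> partial_u \<phi> p"

definition fundamental_F :: "(real \<times> real \<Rightarrow> real^3) \<Rightarrow> real \<times> real \<Rightarrow> real" where
  "fundamental_F \<phi> p = partial_u \<phi> p \<bullet> partial_v \<phi> p"

definition fundamental_G :: "(real \<times> real \<Rightarrow> real^3) \<Rightarrow> real \<times> real \<Rightarrow> real" where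
  "fundamental_G \<phi> p = partial_v \<phi> p \<bullet> partial_v \<phi> p"

definition surface_patch ::
    "(real^3) set \<Rightarrow> (real \<times> real) set \<Rightarrow> (real \<times> real \<Rightarrow> real^3) \<Rightarrow> bool" where
  "surface_patch M U \<phi> \<longleftrightarrow>
     open U \<and> smooth_on U \<phi> \<and>
     openin (top_of_set M) (\<phi> ` U) \<and>
     (\<exists>\<psi>. homeomorphism U (\<phi> ` U) \<phi> \<psi>) \<and>
     (\<forall>p\<in>U. surface_normal \<phi> p \<noteq> 0)"

definition smooth_surface :: "(real^3) set \<Rightarrow> bool" where
  "smooth_surface M \<longleftrightarrow> (\<forall>x\<in>M. \<exists>U \<phi>. surface_patch M U \<phi> \<and> x \<in> \<phi> ` U)"

text \<open>
  A map between surfaces is smooth if it is smooth, as a map into the ambient space, when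
  read in every patch of the domain.
\<close>

definition smooth_surface_map ::
    "(real^3) set \<Rightarrow> (real^3) set \<Rightarrow> (real^3 \<Rightarrow> real^3) \<Rightarrow> bool" where
  "smooth_surface_map M N f \<longleftrightarrow>
     f ` M \<subseteq> N \<and> (\<forall>U \<phi>. surface_patch M U \<phi> \<longrightarrow> smooth_on U (f \<circ> \<phi>))"

definition surface_diffeomorphism ::
    "(real^3) set \<Rightarrow> (real^3) set \<Rightarrow> (real^3 \<Rightarrow> real^3) \<Rightarrow> bool" where
  "surface_diffeomorphism M N f \<longleftrightarrow>
     bij_betw f M N \<and> smooth_surface_map M N f \<and> smooth_surface_map N M (inv_into M f)"

definition homothetic_map ::
    "(real^3) set \<Rightarrow> (real^3) set \<Rightarrow> (real^3 \<Rightarrow> real^3) \<Rightarrow> real \<Rightarrow> bool" where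
  "homothetic_map M N J c \<longleftrightarrow>
     surface_diffeomorphism M N J \<and>
     (\<forall>U \<phi>. surface_patch M U \<phi> \<longrightarrow>
        (\<forall>p\<in>U. fundamental_E (J \<circ> \<phi>) p = c\<^sup>2 * fundamental_E \<phi> p \<and>
               fundamental_F (J \<circ> \<phi>) p = c\<^sup>2 * fundamental_F \<phi> p \<and>
               fundamental_G (J \<circ> \<phi>) p = c\<^sup>2 * fundamental_G \<phi> p))"

definition homothetic_invariant_on :: "'a set \<Rightarrow> ('a \<Rightarrow> real) \<Rightarrow> ('a \<Rightarrow> real) \<Rightarrow> bool" where
  "homothetic_invariant_on I f fbar \<longleftrightarrow>
     (\<exists>k. k \<noteq> 0 \<and> k \<noteq> 1 \<and> (\<forall>s\<in>I. fbar s = k\<^sup>2 * f s))"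

end

theory Submission
  imports Defs
begin

text \<open>
  Write \<open>f\<close> for a patch, \<open>D f\<close> for its derivative and \<open>\<gamma>\<close> for the curve in the parameter domain,
  so that the space curve is \<open>\<beta> = f \<circ> \<gamma>\<close>.  A rectifying curve with the given coefficients has
  normal component \<open>\<beta> \<bullet> N = (\<mu> / \<kappa>) (\<beta>' \<times> \<beta>'') \<bullet> N\<close>, the tangential term being orthogonal to \<open>N\<close>.
  Since \<open>N = f\<^sub>u \<times> f\<^sub>v\<close>, the Lagrange identity (\<open>dot_cross\<close>) gives
  \<open>(\<beta>' \<times> \<beta>'') \<bullet> N = (\<beta>' \<bullet> f\<^sub>u) (\<beta>'' \<bullet> f\<^sub>v) - (\<beta>' \<bullet> f\<^sub>v) (\<beta>'' \<bullet> f\<^sub>u)\<close>.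
  So only inner products of \<open>\<beta>'\<close> and \<open>\<beta>''\<close> with tangent vectors occur, and these are intrinsic:
  \<open>\<beta>'\<close> is itself tangent, while \<open>\<beta>''\<close> consists of a tangent vector and of second derivatives of
  \<open>f\<close>, whose tangential components are determined by the first fundamental form through the Koszul
  formula for the Christoffel symbols (\<open>koszul_formula\<close>).  If the map multiplies the first
  fundamental form by the constant \<open>c\<^sup>2\<close>, it multiplies each of the four factors by \<open>c\<^sup>2\<close>
  (\<open>second_derivative_tangential_homothetic\<close>), hence the normal component by \<open>c ^ 4\<close>
  (\<open>cross_velocity_acceleration_normal_homothetic\<close>).

  The Koszul formula rests on the symmetry of second derivatives, which is proved below by the
  mean value theorem applied to second differences.
\<close>

section \<open>Second derivatives of twice continuously differentiable maps\<close>

text \<open>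
  In \<open>D2 f x a b\<close> the map is differentiated first in direction \<open>a\<close> and then in direction \<open>b\<close>.
\<close>

abbreviation D2 :: "('a::euclidean_space \<Rightarrow> 'b::real_normed_vector) \<Rightarrow> 'a \<Rightarrow> 'a \<Rightarrow> 'a \<Rightarrow> 'b" where
  "D2 f x a b \<equiv> frechet_derivative (\<lambda>y. frechet_derivative f (at y) a) (at x) b"

lemma smooth_on_imp_C2: "smooth_on S f \<Longrightarrow> Ck_on 2 f S"
  by (simp add: smooth_on_def)

lemma C2_has_derivative:
  assumes "Ck_on 2 f S" "x \<in> S"
  shows "(f has_derivative frechet_derivative f (at x)) (at x)"
  using assms by (auto simp: numeral_2_eq_2 frechet_derivative_works)

lemma C2_has_second_derivative:
  assumes "Ck_on 2 f S" "x \<in> S"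
  shows "((\<lambda>y. frechet_derivative f (at y) a) has_derivative D2 f x a) (at x)"
  using assms by (auto simp: numeral_2_eq_2 frechet_derivative_works)

lemma C2_continuous_second_derivative:
  "Ck_on 2 f S \<Longrightarrow> continuous_on S (\<lambda>x. D2 f x a b)"
  by (auto simp: numeral_2_eq_2)

text \<open>
  The mean value theorem is used twice: along \<open>a\<close>, on the difference of \<open>f\<close> between the two sides
  of the parallelogram parallel to \<open>a\<close>, and then along \<open>b\<close>, on the derivative of \<open>f\<close> in direction
  \<open>a\<close>.  The left-hand side is symmetric in \<open>a\<close> and \<open>b\<close>, which makes the order of differentiation on
  the right-hand side immaterial in the limit.
\<close>

lemma second_difference_mean_value:
  fixes f :: "'a::real_normed_vector \<Rightarrow> real"
  assumes "h > 0"
    and inS: "\<And>s t. 0 \<le> s \<Longrightarrow> s \<le> h \<Longrightarrow> 0 \<le> t \<Longrightarrow> t \<le> h \<Longrightarrow> x + s *\<^sub>R a + t *\<^sub>R b \<in> S"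
    and f': "\<And>y. y \<in> S \<Longrightarrow> (f has_derivative f' y) (at y)"
    and f'': "\<And>y. y \<in> S \<Longrightarrow> ((\<lambda>y. f' y a) has_derivative f'' y) (at y)"
  shows "\<exists>s t. 0 < s \<and> s < h \<and> 0 < t \<and> t < h \<and>
    f (x + h *\<^sub>R a + h *\<^sub>R b) - f (x + h *\<^sub>R a) - f (x + h *\<^sub>R b) + f x
      = h\<^sup>2 * f'' (x + s *\<^sub>R a + t *\<^sub>R b) b"
proof -
  let ?p = "\<lambda>s t. x + s *\<^sub>R a + t *\<^sub>R b"
  have along_a: "((\<lambda>s. f (?p s t)) has_real_derivative f' (?p s t) a) (at s)"
    if "0 \<le> s" "s \<le> h" "0 \<le> t" "t \<le> h" for s t
  proof -
    have p: "((\<lambda>s. ?p s t) has_vector_derivative a) (at s)"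
      by (auto intro!: derivative_eq_intros)
    show ?thesis
      using has_derivative_compose[OF p[unfolded has_vector_derivative_def] f'[OF inS[OF that]]]
        linear_scale[OF has_derivative_linear[OF f'[OF inS[OF that]]]]
      by (simp add: has_field_derivative_def mult.commute[of "f' _ a"] mult_commute_abs)
  qed
  have along_b: "((\<lambda>t. f' (?p s t) a) has_real_derivative f'' (?p s t) b) (at t)"
    if "0 \<le> s" "s \<le> h" "0 \<le> t" "t \<le> h" for s t
  proof -
    have p: "((\<lambda>t. ?p s t) has_vector_derivative b) (at t)"
      by (auto intro!: derivative_eq_intros)
    show ?thesis
      using has_derivative_compose[OF p[unfolded has_vector_derivative_def] f''[OF inS[OF that]]]
        linear_scale[OF has_derivative_linear[OF f''[OF inS[OF that]]]]
      by (simp add: has_field_derivative_def mult.commute[of "f'' _ b"] mult_commute_abs)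
  qed
  have "\<exists>s. 0 < s \<and> s < h \<and> (f (?p h h) - f (?p h 0)) - (f (?p 0 h) - f (?p 0 0))
      = (h - 0) * (f' (?p s h) a - f' (?p s 0) a)"
    using \<open>h > 0\<close>
    by (intro along_a MVT2[where f="\<lambda>s. f (?p s h) - f (?p s 0)" and f'="\<lambda>s. f' (?p s h) a - f' (?p s 0) a"]
        DERIV_diff) simp_all
  then obtain s where s: "0 < s" "s < h" and
    seq: "(f (?p h h) - f (?p h 0)) - (f (?p 0 h) - f (?p 0 0))
      = (h - 0) * (f' (?p s h) a - f' (?p s 0) a)" by blast
  have "\<exists>t. 0 < t \<and> t < h \<and> f' (?p s h) a - f' (?p s 0) a = (h - 0) * f'' (?p s t) b"
    using \<open>h > 0\<close> along_b s
    by (intro MVT2[where f="\<lambda>t. f' (?p s t) a" and f'="\<lambda>t. f'' (?p s t) b"]) auto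
  then obtain t where t: "0 < t" "t < h" and
    teq: "f' (?p s h) a - f' (?p s 0) a = (h - 0) * f'' (?p s t) b" by blast
  have "f (?p h h) - f (?p h 0) - f (?p 0 h) + f x = h\<^sup>2 * f'' (?p s t) b"
    using seq teq by (simp add: power2_eq_square)
  with s t show ?thesis by (intro exI[of _ s] exI[of _ t]) simp
qed

text \<open>
  Schwarz's theorem: on a small parallelogram, each mixed derivative at some point equals the same
  second difference divided by \<open>h\<^sup>2\<close>, so by continuity the two derivatives cannot differ at \<open>x\<close>.
\<close>

lemma second_derivative_symmetric_real:
  fixes f :: "'a::real_normed_vector \<Rightarrow> real"
  assumes S: "open S" "x \<in> S"
    and f': "\<And>y. y \<in> S \<Longrightarrow> (f has_derivative f' y) (at y)"
    and fa: "\<And>y. y \<in> S \<Longrightarrow> ((\<lambda>y. f' y a) has_derivative fa y) (at y)"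
    and fb: "\<And>y. y \<in> S \<Longrightarrow> ((\<lambda>y. f' y b) has_derivative fb y) (at y)"
    and ca: "continuous_on S (\<lambda>y. fa y b)" and cb: "continuous_on S (\<lambda>y. fb y a)"
  shows "fa x b = fb x a"
proof (rule ccontr)
  assume ne: "fa x b \<noteq> fb x a"
  define e where "e = \<bar>fa x b - fb x a\<bar> / 2"
  have "e > 0" using ne by (simp add: e_def)
  have "(\<lambda>y. fa y b) \<midarrow>x\<rightarrow> fa x b" "(\<lambda>y. fb y a) \<midarrow>x\<rightarrow> fb x a"
    using S ca cb by (auto simp: continuous_on_eq_continuous_at isCont_def)
  then have "\<forall>\<^sub>F y in nhds x. dist (fa y b) (fa x b) < e"
    "\<forall>\<^sub>F y in nhds x. dist (fb y a) (fb x a) < e"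
    "\<forall>\<^sub>F y in nhds x. y \<in> S"
    using \<open>e > 0\<close> S
    by (auto simp: tendsto_iff eventually_at_filter eventually_nhds_in_open elim!: eventually_mono)
  then have "\<forall>\<^sub>F y in nhds x. dist (fa y b) (fa x b) < e \<and> dist (fb y a) (fb x a) < e \<and> y \<in> S"
    by eventually_elim simp
  then obtain d where "d > 0" and
    d: "\<And>y. dist y x < d \<Longrightarrow> dist (fa y b) (fa x b) < e \<and> dist (fb y a) (fb x a) < e \<and> y \<in> S"
    by (auto simp: eventually_nhds_metric)
  \<comment> \<open>The parallelogram spanned by \<open>h a\<close> and \<open>h b\<close> then lies in the ball of radius \<open>d\<close>; the
    summand 1 allows for \<open>a = b = 0\<close>.\<close>
  define h where "h = d / (norm a + norm b + 1)"
  have "h > 0" using \<open>d > 0\<close> unfolding h_def by (intro divide_pos_pos add_nonneg_pos) auto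
  have near: "dist (x + s *\<^sub>R a + t *\<^sub>R b) x < d" if "0 \<le> s" "s \<le> h" "0 \<le> t" "t \<le> h" for s t
  proof -
    have "dist (x + s *\<^sub>R a + t *\<^sub>R b) x = norm (s *\<^sub>R a + t *\<^sub>R b)"
      by (simp add: dist_norm)
    also have "\<dots> \<le> s * norm a + t * norm b"
      using norm_triangle_ineq[of "s *\<^sub>R a" "t *\<^sub>R b"] that by simp
    also have "\<dots> \<le> h * norm a + h * norm b"
      using that by (intro add_mono mult_right_mono) auto
    also have "\<dots> < h * (norm a + norm b + 1)"
      using \<open>h > 0\<close> by (simp add: algebra_simps)
    also have "\<dots> = d"
      unfolding h_def using norm_ge_zero[of a] norm_ge_zero[of b] by (simp add: add_nonneg_eq_0_iff)
    finally show ?thesis .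
  qed
  have inS: "x + s *\<^sub>R a + t *\<^sub>R b \<in> S" if "0 \<le> s" "s \<le> h" "0 \<le> t" "t \<le> h" for s t
    using d near that by blast
  obtain s t where st: "0 < s" "s < h" "0 < t" "t < h" and
    ab: "f (x + h *\<^sub>R a + h *\<^sub>R b) - f (x + h *\<^sub>R a) - f (x + h *\<^sub>R b) + f x
      = h\<^sup>2 * fa (x + s *\<^sub>R a + t *\<^sub>R b) b"
    using second_difference_mean_value[OF \<open>h > 0\<close> inS f' fa] by auto
  have near': "dist (x + s *\<^sub>R b + t *\<^sub>R a) x < d" if "0 \<le> s" "s \<le> h" "0 \<le> t" "t \<le> h" for s t
    using near[of t s] that by (simp add: algebra_simps)
  have inS': "x + s *\<^sub>R b + t *\<^sub>R a \<in> S" if "0 \<le> s" "s \<le> h" "0 \<le> t" "t \<le> h" for s t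
    using d near' that by blast
  obtain s' t' where st': "0 < s'" "s' < h" "0 < t'" "t' < h" and
    ba: "f (x + h *\<^sub>R b + h *\<^sub>R a) - f (x + h *\<^sub>R b) - f (x + h *\<^sub>R a) + f x
      = h\<^sup>2 * fb (x + s' *\<^sub>R b + t' *\<^sub>R a) a"
    using second_difference_mean_value[OF \<open>h > 0\<close> inS' f' fb] by auto
  have "h\<^sup>2 * fa (x + s *\<^sub>R a + t *\<^sub>R b) b = h\<^sup>2 * fb (x + s' *\<^sub>R b + t' *\<^sub>R a) a"
    using ab ba by (simp add: algebra_simps)
  then have "fa (x + s *\<^sub>R a + t *\<^sub>R b) b = fb (x + s' *\<^sub>R b + t' *\<^sub>R a) a"
    using \<open>h > 0\<close> by simp
  moreover have "dist (fa (x + s *\<^sub>R a + t *\<^sub>R b) b) (fa x b) < e"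
    using d near st by simp
  moreover have "dist (fb (x + s' *\<^sub>R b + t' *\<^sub>R a) a) (fb x a) < e"
    using d near' st' by simp
  ultimately show False
    unfolding e_def dist_real_def by (auto simp: field_simps abs_if split: if_splits)
qed

lemma second_derivative_symmetric:
  fixes f :: "'a::euclidean_space \<Rightarrow> 'b::real_inner"
  assumes S: "open S" "x \<in> S" and f: "Ck_on 2 f S"
  shows "D2 f x a b = D2 f x b a"
proof -
  have "D2 f x a b \<bullet> w = D2 f x b a \<bullet> w" for w
  proof (rule second_derivative_symmetric_real[OF S,
        where f = "\<lambda>y. f y \<bullet> w" and f' = "\<lambda>y h. frechet_derivative f (at y) h \<bullet> w"
          and fa = "\<lambda>y h. D2 f y a h \<bullet> w" and fb = "\<lambda>y h. D2 f y b h \<bullet> w"])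
    show "((\<lambda>y. f y \<bullet> w) has_derivative (\<lambda>h. frechet_derivative f (at y) h \<bullet> w)) (at y)"
      if "y \<in> S" for y
      using C2_has_derivative[OF f that] by (rule has_derivative_inner_left)
    show "((\<lambda>y. frechet_derivative f (at y) a \<bullet> w) has_derivative (\<lambda>h. D2 f y a h \<bullet> w)) (at y)"
      if "y \<in> S" for y
      using C2_has_second_derivative[OF f that] by (rule has_derivative_inner_left)
    show "((\<lambda>y. frechet_derivative f (at y) b \<bullet> w) has_derivative (\<lambda>h. D2 f y b h \<bullet> w)) (at y)"
      if "y \<in> S" for y
      using C2_has_second_derivative[OF f that] by (rule has_derivative_inner_left)
  qed (intro continuous_intros C2_continuous_second_derivative[OF f])+
  then show ?thesis using vector_eq_rdot by blast
qed

section \<open>The first fundamental form\<close>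

definition first_fundamental_form ::
    "('a::euclidean_space \<Rightarrow> 'b::real_inner) \<Rightarrow> 'a \<Rightarrow> 'a \<Rightarrow> 'a \<Rightarrow> real" where
  "first_fundamental_form f x a b = frechet_derivative f (at x) a \<bullet> frechet_derivative f (at x) b"

lemma first_fundamental_form_has_derivative:
  fixes f :: "'a::euclidean_space \<Rightarrow> 'b::real_inner"
  assumes "Ck_on 2 f S" "x \<in> S"
  shows "((\<lambda>y. first_fundamental_form f y a b) has_derivative
    (\<lambda>w. frechet_derivative f (at x) a \<bullet> D2 f x b w + D2 f x a w \<bullet> frechet_derivative f (at x) b))
    (at x)"
  unfolding first_fundamental_form_def
  by (intro has_derivative_inner C2_has_second_derivative[OF assms])

text \<open>
  By the product rule each derivative of the form is a sum of two terms
  \<open>D2 f x _ _ \<bullet> D f _\<close>.  By symmetry of \<open>D2\<close>, the two terms that contain \<open>D2 f x a b\<close> agree and the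
  other four cancel.
\<close>

lemma koszul_formula:
  fixes f :: "'a::euclidean_space \<Rightarrow> 'b::real_inner"
  assumes S: "open S" "x \<in> S" and f: "Ck_on 2 f S"
  defines "g \<equiv> first_fundamental_form f"
  shows "2 * (D2 f x a b \<bullet> frechet_derivative f (at x) w) =
    frechet_derivative (\<lambda>y. g y a w) (at x) b + frechet_derivative (\<lambda>y. g y b w) (at x) a
      - frechet_derivative (\<lambda>y. g y a b) (at x) w"
proof -
  have g': "frechet_derivative (\<lambda>y. g y a b) (at x) w =
      frechet_derivative f (at x) a \<bullet> D2 f x b w + D2 f x a w \<bullet> frechet_derivative f (at x) b"
    for a b w
    unfolding g_def
    by (rule fun_cong[OF frechet_derivative_at[OF first_fundamental_form_has_derivative[OF f S(2)],
            symmetric]])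
  show ?thesis
    unfolding g' second_derivative_symmetric[OF S f, of w] second_derivative_symmetric[OF S f, of b a]
    by (simp add: inner_commute)
qed

text \<open>
  The proportionality of the two forms may be differentiated because it holds on all of the open
  set \<open>S\<close> with the same factor; the Koszul formula then transfers it to the second derivatives.
\<close>

lemma second_derivative_tangential_homothetic:
  fixes f fbar :: "'a::euclidean_space \<Rightarrow> 'b::real_inner"
  assumes S: "open S" "x \<in> S" and f: "Ck_on 2 f S" and fbar: "Ck_on 2 fbar S"
    and g: "\<And>y a b. y \<in> S \<Longrightarrow>
      first_fundamental_form fbar y a b = r * first_fundamental_form f y a b"
  shows "D2 fbar x a b \<bullet> frechet_derivative fbar (at x) w =
    r * (D2 f x a b \<bullet> frechet_derivative f (at x) w)"
proof -
  have "frechet_derivative (\<lambda>y. first_fundamental_form fbar y a b) (at x) w =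
      r * frechet_derivative (\<lambda>y. first_fundamental_form f y a b) (at x) w" for a b w
  proof -
    let ?G = "\<lambda>y. first_fundamental_form f y a b"
    have "?G differentiable (at x)"
      by (rule differentiableI) (rule first_fundamental_form_has_derivative[OF f S(2)])
    then have "(?G has_derivative frechet_derivative ?G (at x)) (at x)"
      by (rule frechet_derivative_works[THEN iffD1])
    then have "((\<lambda>y. r * ?G y) has_derivative (\<lambda>h. r * frechet_derivative ?G (at x) h)) (at x)"
      by (rule has_derivative_mult_right)
    then have "((\<lambda>y. first_fundamental_form fbar y a b) has_derivative
        (\<lambda>h. r * frechet_derivative ?G (at x) h)) (at x)"
      using S by (rule has_derivative_transform_within_open) (simp add: g)
    from fun_cong[OF frechet_derivative_at[OF this, symmetric]] show ?thesis .
  qed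
  then have "2 * (D2 fbar x a b \<bullet> frechet_derivative fbar (at x) w) =
      r * (2 * (D2 f x a b \<bullet> frechet_derivative f (at x) w))"
    unfolding koszul_formula[OF S f] koszul_formula[OF S fbar] by (simp add: algebra_simps)
  then show ?thesis by simp
qed

section \<open>Curves on a parametrised surface\<close>

lemma velocity_composition:
  fixes f :: "'a::euclidean_space \<Rightarrow> real^3"
  assumes f: "Ck_on 2 f S" "\<gamma> s \<in> S" and \<gamma>: "(\<gamma> has_vector_derivative \<gamma>') (at s)"
  shows "velocity (\<lambda>s. f (\<gamma> s)) s = frechet_derivative f (at (\<gamma> s)) \<gamma>'"
  using has_derivative_compose[OF \<gamma>[unfolded has_vector_derivative_def] C2_has_derivative[OF f]]
    linear_scale[OF has_derivative_linear[OF C2_has_derivative[OF f]]]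
  by (intro vector_derivative_at) (simp add: has_vector_derivative_def)

text \<open>
  The velocity is expanded in coordinates, so that the only maps to be differentiated along the
  curve are the directional derivatives of \<open>f\<close> in constant directions.
\<close>

lemma acceleration_composition:
  fixes f :: "'a::euclidean_space \<Rightarrow> real^3"
  assumes f: "Ck_on 2 f S" and I: "open I" "s \<in> I" and \<gamma>S: "\<And>s. s \<in> I \<Longrightarrow> \<gamma> s \<in> S"
    and \<gamma>: "\<And>s. s \<in> I \<Longrightarrow> (\<gamma> has_vector_derivative \<gamma>' s) (at s)"
    and \<gamma>': "(\<gamma>' has_vector_derivative \<gamma>'') (at s)"
  shows "acceleration (\<lambda>s. f (\<gamma> s)) s =
    (\<Sum>i\<in>Basis. (\<gamma>' s \<bullet> i) *\<^sub>R D2 f (\<gamma> s) i (\<gamma>' s)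
      + (\<gamma>'' \<bullet> i) *\<^sub>R frechet_derivative f (at (\<gamma> s)) i)"
proof -
  have expand: "velocity (\<lambda>s. f (\<gamma> s)) s =
      (\<Sum>i\<in>Basis. (\<gamma>' s \<bullet> i) *\<^sub>R frechet_derivative f (at (\<gamma> s)) i)" if "s \<in> I" for s
  proof -
    have lin: "linear (frechet_derivative f (at (\<gamma> s)))"
      using C2_has_derivative[OF f \<gamma>S[OF that]] by (rule has_derivative_linear)
    have "velocity (\<lambda>s. f (\<gamma> s)) s = frechet_derivative f (at (\<gamma> s)) (\<gamma>' s)"
      using f \<gamma>S[OF that] \<gamma>[OF that] by (rule velocity_composition)
    also have "\<dots> = frechet_derivative f (at (\<gamma> s)) (\<Sum>i\<in>Basis. (\<gamma>' s \<bullet> i) *\<^sub>R i)"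
      by (simp add: euclidean_representation)
    also have "\<dots> = (\<Sum>i\<in>Basis. (\<gamma>' s \<bullet> i) *\<^sub>R frechet_derivative f (at (\<gamma> s)) i)"
      by (simp only: linear_sum[OF lin] linear_scale[OF lin])
    finally show ?thesis .
  qed
  have coeff: "((\<lambda>s. \<gamma>' s \<bullet> i) has_real_derivative \<gamma>'' \<bullet> i) (at s)" for i
    using has_derivative_inner_left[OF \<gamma>'[unfolded has_vector_derivative_def], of i]
    by (simp add: has_field_derivative_def mult_commute_abs)
  have vec: "((\<lambda>s. frechet_derivative f (at (\<gamma> s)) i) has_vector_derivative D2 f (\<gamma> s) i (\<gamma>' s)) (at s)"
    for i
    using has_derivative_compose[OF \<gamma>[OF I(2), unfolded has_vector_derivative_def]
        C2_has_second_derivative[OF f \<gamma>S[OF I(2)]]]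
      linear_scale[OF has_derivative_linear[OF C2_has_second_derivative[OF f \<gamma>S[OF I(2)]]]]
    by (simp add: has_vector_derivative_def)
  have "((\<lambda>s. \<Sum>i\<in>Basis. (\<gamma>' s \<bullet> i) *\<^sub>R frechet_derivative f (at (\<gamma> s)) i) has_vector_derivative
    (\<Sum>i\<in>Basis. (\<gamma>' s \<bullet> i) *\<^sub>R D2 f (\<gamma> s) i (\<gamma>' s)
      + (\<gamma>'' \<bullet> i) *\<^sub>R frechet_derivative f (at (\<gamma> s)) i)) (at s)"
    by (intro has_vector_derivative_sum has_vector_derivative_scaleR coeff vec)
  then have "(velocity (\<lambda>s. f (\<gamma> s)) has_vector_derivative
    (\<Sum>i\<in>Basis. (\<gamma>' s \<bullet> i) *\<^sub>R D2 f (\<gamma> s) i (\<gamma>' s)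
      + (\<gamma>'' \<bullet> i) *\<^sub>R frechet_derivative f (at (\<gamma> s)) i)) (at s)"
    using I by (rule has_vector_derivative_transform_within_open) (simp add: expand)
  then show ?thesis by (rule vector_derivative_at)
qed

lemma C2_curve_has_vector_derivative:
  fixes u :: "real \<Rightarrow> 'b::real_normed_vector"
  assumes u: "Ck_on 2 u I" and s: "s \<in> I"
  shows "(u has_vector_derivative frechet_derivative u (at s) 1) (at s)"
    and "((\<lambda>s. frechet_derivative u (at s) 1) has_vector_derivative D2 u s 1 1) (at s)"
proof -
  have vec: "(f has_vector_derivative L 1) (at s)" if "(f has_derivative L) (at s)"
    for f :: "real \<Rightarrow> 'b" and L
  proof -
    have "L t = t *\<^sub>R L 1" for t
      using linear_scale[OF has_derivative_linear[OF that], of t 1] by simp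
    then have "L = (\<lambda>t. t *\<^sub>R L 1)" by (rule ext)
    with that show ?thesis
      unfolding has_vector_derivative_def by (rule has_derivative_eq_rhs)
  qed
  show "(u has_vector_derivative frechet_derivative u (at s) 1) (at s)"
    by (rule vec) (rule C2_has_derivative[OF u s])
  show "((\<lambda>s. frechet_derivative u (at s) 1) has_vector_derivative D2 u s 1 1) (at s)"
    by (rule vec) (rule C2_has_second_derivative[OF u s])
qed

text \<open>
  The Lagrange identity turns both sides into products of one inner product with the velocity and
  one with the acceleration; each contributes a factor \<open>r\<close>.
\<close>

lemma cross_velocity_acceleration_normal_homothetic:
  fixes f fbar :: "'a::euclidean_space \<Rightarrow> real^3"
  assumes S: "open S" and f: "Ck_on 2 f S" and fbar: "Ck_on 2 fbar S"
    and g: "\<And>y a b. y \<in> S \<Longrightarrow>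
      first_fundamental_form fbar y a b = r * first_fundamental_form f y a b"
    and I: "open I" "s \<in> I" and \<gamma>S: "\<And>s. s \<in> I \<Longrightarrow> \<gamma> s \<in> S"
    and \<gamma>: "\<And>s. s \<in> I \<Longrightarrow> (\<gamma> has_vector_derivative \<gamma>' s) (at s)"
    and \<gamma>': "(\<gamma>' has_vector_derivative \<gamma>'') (at s)"
  defines "\<beta> \<equiv> \<lambda>s. f (\<gamma> s)" and "\<beta>bar \<equiv> \<lambda>s. fbar (\<gamma> s)"
  shows "cross3 (velocity \<beta>bar s) (acceleration \<beta>bar s) \<bullet>
      cross3 (frechet_derivative fbar (at (\<gamma> s)) a) (frechet_derivative fbar (at (\<gamma> s)) b) =
    r\<^sup>2 * (cross3 (velocity \<beta> s) (acceleration \<beta> s) \<bullet>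
      cross3 (frechet_derivative f (at (\<gamma> s)) a) (frechet_derivative f (at (\<gamma> s)) b))"
proof -
  have x: "\<gamma> s \<in> S" using \<gamma>S I by blast
  have vel: "velocity \<beta>bar s \<bullet> frechet_derivative fbar (at (\<gamma> s)) w =
      r * (velocity \<beta> s \<bullet> frechet_derivative f (at (\<gamma> s)) w)" for w
    using g[OF x] unfolding \<beta>_def \<beta>bar_def first_fundamental_form_def
      velocity_composition[OF f x \<gamma>[OF I(2)]] velocity_composition[OF fbar x \<gamma>[OF I(2)]] .
  have acc_\<beta>: "acceleration \<beta> s = (\<Sum>i\<in>Basis. (\<gamma>' s \<bullet> i) *\<^sub>R D2 f (\<gamma> s) i (\<gamma>' s)
      + (\<gamma>'' \<bullet> i) *\<^sub>R frechet_derivative f (at (\<gamma> s)) i)"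
    unfolding \<beta>_def by (rule acceleration_composition[OF f I \<gamma>S \<gamma> \<gamma>'])
  have acc_\<beta>bar: "acceleration \<beta>bar s = (\<Sum>i\<in>Basis. (\<gamma>' s \<bullet> i) *\<^sub>R D2 fbar (\<gamma> s) i (\<gamma>' s)
      + (\<gamma>'' \<bullet> i) *\<^sub>R frechet_derivative fbar (at (\<gamma> s)) i)"
    unfolding \<beta>bar_def by (rule acceleration_composition[OF fbar I \<gamma>S \<gamma> \<gamma>'])
  have acc: "acceleration \<beta>bar s \<bullet> frechet_derivative fbar (at (\<gamma> s)) w =
      r * (acceleration \<beta> s \<bullet> frechet_derivative f (at (\<gamma> s)) w)" for w
    unfolding acc_\<beta> acc_\<beta>bar
    using g[OF x, unfolded first_fundamental_form_def]
      second_derivative_tangential_homothetic[OF S x f fbar g]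
    by (simp add: inner_sum_left sum_distrib_left algebra_simps)
  show ?thesis
    unfolding dot_cross vel acc by (simp add: algebra_simps power2_eq_square)
qed

text \<open>
  At unit speed the unit tangent is the velocity, so its derivative is the acceleration, whose norm
  is the curvature; dividing by it turns \<open>\<alpha>' \<times> \<alpha>''\<close> into the binormal.
\<close>

lemma rectifying_curve_unit_speed:
  assumes I: "open I" "s \<in> I" and "unit_speed I \<alpha>"
    and "rectifying_coefficients I \<alpha> \<xi> \<mu>"
  shows "\<alpha> s = \<xi> s *\<^sub>R velocity \<alpha> s
    + (\<mu> s / curvature \<alpha> s) *\<^sub>R cross3 (velocity \<alpha> s) (acceleration \<alpha> s)"
proof -
  have T: "unit_tangent \<alpha> t = velocity \<alpha> t" if "t \<in> I" for t
    using assms that by (simp add: unit_tangent_def unit_speed_def)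
  have "\<forall>\<^sub>F t in nhds s. unit_tangent \<alpha> t = velocity \<alpha> t"
    using eventually_nhds_in_open[OF I] by eventually_elim (rule T)
  then have "vector_derivative (unit_tangent \<alpha>) (at s) = acceleration \<alpha> s"
    by (intro vector_derivative_cong_eq) (auto elim: eventually_mono)
  then show ?thesis
    using assms T[OF I(2)]
    by (simp add: rectifying_coefficients_def unit_speed_def binormal_def principal_normal_def
        curvature_def cross_mult_right divide_inverse)
qed

section \<open>Surface patches\<close>

lemma partial_u_eq_frechet_derivative:
  assumes f: "Ck_on 2 \<phi> U" and p: "p \<in> U"
  shows "partial_u \<phi> p = frechet_derivative \<phi> (at p) (1, 0)"
proof -
  have "((\<lambda>t. (t, snd p)) has_vector_derivative (1, 0)) (at (fst p))"
    by (auto intro!: derivative_eq_intros)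
  from velocity_composition[of \<phi> U, OF f _ this] p show ?thesis
    by (simp add: partial_u_def)
qed

lemma partial_v_eq_frechet_derivative:
  assumes f: "Ck_on 2 \<phi> U" and p: "p \<in> U"
  shows "partial_v \<phi> p = frechet_derivative \<phi> (at p) (0, 1)"
proof -
  have "((\<lambda>t. (fst p, t)) has_vector_derivative (0, 1)) (at (snd p))"
    by (auto intro!: derivative_eq_intros)
  from velocity_composition[of \<phi> U, OF f _ this] p show ?thesis
    by (simp add: partial_v_def)
qed

lemma frechet_derivative_partials:
  assumes f: "Ck_on 2 \<phi> U" and p: "p \<in> U"
  shows "frechet_derivative \<phi> (at p) a = fst a *\<^sub>R partial_u \<phi> p + snd a *\<^sub>R partial_v \<phi> p"
proof -
  have lin: "linear (frechet_derivative \<phi> (at p))"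
    using C2_has_derivative[OF f p] by (rule has_derivative_linear)
  have "frechet_derivative \<phi> (at p) a =
      frechet_derivative \<phi> (at p) (fst a *\<^sub>R (1, 0) + snd a *\<^sub>R (0, 1))"
    by simp
  also have "\<dots> = fst a *\<^sub>R frechet_derivative \<phi> (at p) (1, 0)
      + snd a *\<^sub>R frechet_derivative \<phi> (at p) (0, 1)"
    by (simp only: linear_add[OF lin] linear_scale[OF lin])
  finally show ?thesis
    unfolding partial_u_eq_frechet_derivative[OF f p] partial_v_eq_frechet_derivative[OF f p] .
qed

text \<open>
  Thus scaling \<open>E\<close>, \<open>F\<close> and \<open>G\<close> by a common factor scales the whole first fundamental form by it.
\<close>

lemma first_fundamental_form_EFG:
  assumes f: "Ck_on 2 \<phi> U" and p: "p \<in> U"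
  shows "first_fundamental_form \<phi> p a b =
    fst a * fst b * fundamental_E \<phi> p
      + (fst a * snd b + snd a * fst b) * fundamental_F \<phi> p + snd a * snd b * fundamental_G \<phi> p"
  unfolding first_fundamental_form_def frechet_derivative_partials[OF f p]
    fundamental_E_def fundamental_F_def fundamental_G_def
  by (simp add: inner_commute algebra_simps)

lemma velocity_orthogonal_surface_normal:
  assumes f: "Ck_on 2 \<phi> U" and p: "\<gamma> s \<in> U"
    and \<gamma>: "(\<gamma> has_vector_derivative \<gamma>') (at s)"
  shows "velocity (\<lambda>s. \<phi> (\<gamma> s)) s \<bullet> surface_normal \<phi> (\<gamma> s) = 0"
  by (simp add: velocity_composition[OF f p \<gamma>] frechet_derivative_partials[OF f p]
      surface_normal_def inner_add_left dot_cross_self)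

theorem corollary3p5:
  fixes M Mbar :: "(real^3) set" and J :: "real^3 \<Rightarrow> real^3" and c :: real
    and U :: "(real \<times> real) set" and \<phi> \<phi>bar :: "real \<times> real \<Rightarrow> real^3"
    and I :: "real set" and u v \<xi> \<mu> :: "real \<Rightarrow> real" and \<alpha> \<alpha>bar :: "real \<Rightarrow> real^3"
  assumes "smooth_surface M" and "smooth_surface Mbar"
    and "homothetic_map M Mbar J c" and "c \<noteq> 0" and "c \<noteq> 1"
    and "surface_patch M U \<phi>" and "\<phi>bar = J \<circ> \<phi>"
    and "open I" and "is_interval I"
    and "smooth_on I u" and "smooth_on I v" and "\<And>s. s \<in> I \<Longrightarrow> (u s, v s) \<in> U"
    and "\<alpha> = (\<lambda>s. \<phi> (u s, v s))" and "\<alpha>bar = J \<circ> \<alpha>"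
    and "unit_speed I \<alpha>" and "rectifying_curve I \<alpha>"
    and "rectifying_coefficients I \<alpha> \<xi> \<mu>"
    and "rectifying_curve I \<alpha>bar"
    and "\<And>s. s \<in> I \<Longrightarrow>
           \<alpha>bar s = \<xi> s *\<^sub>R velocity \<alpha>bar s
             + (\<mu> s / curvature \<alpha> s) *\<^sub>R cross3 (velocity \<alpha>bar s) (acceleration \<alpha>bar s)"
  shows "homothetic_invariant_on I
           (\<lambda>s. \<alpha> s \<bullet> surface_normal \<phi> (u s, v s))
           (\<lambda>s. \<alpha>bar s \<bullet> surface_normal \<phi>bar (u s, v s))"
proof -
  define \<gamma> where "\<gamma> = (\<lambda>s. (u s, v s))"
  define \<gamma>' where "\<gamma>' = (\<lambda>s. (frechet_derivative u (at s) 1, frechet_derivative v (at s) 1))"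
  have U: "open U" and \<phi>: "Ck_on 2 \<phi> U"
    using assms(6) by (auto simp: surface_patch_def intro: smooth_on_imp_C2)
  have \<phi>bar: "Ck_on 2 \<phi>bar U"
    using assms(3,6,7)
    by (auto simp: homothetic_map_def surface_diffeomorphism_def smooth_surface_map_def
        intro: smooth_on_imp_C2)
  have g: "first_fundamental_form \<phi>bar p a b = c\<^sup>2 * first_fundamental_form \<phi> p a b"
    if "p \<in> U" for p a b
    using assms(3,6,7) that
    unfolding first_fundamental_form_EFG[OF \<phi> that] first_fundamental_form_EFG[OF \<phi>bar that]
    by (simp add: homothetic_map_def algebra_simps)
  have \<gamma>U: "\<gamma> s \<in> U" if "s \<in> I" for s
    using assms(12)[OF that] by (simp add: \<gamma>_def)
  note u = C2_curve_has_vector_derivative[OF smooth_on_imp_C2[OF assms(10)]]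
  note v = C2_curve_has_vector_derivative[OF smooth_on_imp_C2[OF assms(11)]]
  have \<gamma>: "(\<gamma> has_vector_derivative \<gamma>' s) (at s)" if "s \<in> I" for s
    unfolding \<gamma>_def \<gamma>'_def by (intro has_vector_derivative_Pair u v that)
  have \<gamma>': "(\<gamma>' has_vector_derivative (D2 u s 1 1, D2 v s 1 1)) (at s)" if "s \<in> I" for s
    unfolding \<gamma>'_def by (intro has_vector_derivative_Pair u v that)
  have \<alpha>: "\<alpha> = (\<lambda>s. \<phi> (\<gamma> s))" and \<alpha>bar: "\<alpha>bar = (\<lambda>s. \<phi>bar (\<gamma> s))"
    using assms(7,13,14) by (auto simp: \<gamma>_def)
  have "\<alpha>bar s \<bullet> surface_normal \<phi>bar (\<gamma> s) = (c\<^sup>2)\<^sup>2 * (\<alpha> s \<bullet> surface_normal \<phi> (\<gamma> s))"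
    if s: "s \<in> I" for s
  proof -
    have N: "surface_normal f (\<gamma> s) = cross3 (frechet_derivative f (at (\<gamma> s)) (1, 0))
        (frechet_derivative f (at (\<gamma> s)) (0, 1))" if "Ck_on 2 f U" for f
      by (simp add: surface_normal_def partial_u_eq_frechet_derivative[OF that \<gamma>U[OF s]]
          partial_v_eq_frechet_derivative[OF that \<gamma>U[OF s]])
    have normal_part: "(x *\<^sub>R velocity (\<lambda>s. f (\<gamma> s)) s + y *\<^sub>R w) \<bullet> surface_normal f (\<gamma> s) =
        y * (w \<bullet> surface_normal f (\<gamma> s))" if "Ck_on 2 f U" for f x y w
      by (simp add: inner_add_left velocity_orthogonal_surface_normal[OF that \<gamma>U[OF s] \<gamma>[OF s]])
    have "\<alpha>bar s \<bullet> surface_normal \<phi>bar (\<gamma> s) = (\<mu> s / curvature \<alpha> s) *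
        (cross3 (velocity \<alpha>bar s) (acceleration \<alpha>bar s) \<bullet> surface_normal \<phi>bar (\<gamma> s))"
      using arg_cong[OF assms(19)[OF s], of "\<lambda>x. x \<bullet> surface_normal \<phi>bar (\<gamma> s)"]
      unfolding \<alpha>bar normal_part[OF \<phi>bar] .
    also have "\<dots> = (c\<^sup>2)\<^sup>2 * ((\<mu> s / curvature \<alpha> s) *
        (cross3 (velocity \<alpha> s) (acceleration \<alpha> s) \<bullet> surface_normal \<phi> (\<gamma> s)))"
    proof -
      have "cross3 (velocity \<alpha>bar s) (acceleration \<alpha>bar s) \<bullet> surface_normal \<phi>bar (\<gamma> s) =
          (c\<^sup>2)\<^sup>2 * (cross3 (velocity \<alpha> s) (acceleration \<alpha> s) \<bullet> surface_normal \<phi> (\<gamma> s))"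
        unfolding \<alpha> \<alpha>bar N[OF \<phi>] N[OF \<phi>bar]
        by (rule cross_velocity_acceleration_normal_homothetic
            [OF U \<phi> \<phi>bar g assms(8) s \<gamma>U \<gamma> \<gamma>'[OF s]])
      then show ?thesis by simp
    qed
    also have "(\<mu> s / curvature \<alpha> s) *
        (cross3 (velocity \<alpha> s) (acceleration \<alpha> s) \<bullet> surface_normal \<phi> (\<gamma> s)) =
        \<alpha> s \<bullet> surface_normal \<phi> (\<gamma> s)"
      using arg_cong[OF rectifying_curve_unit_speed[OF assms(8) s assms(15,17)],
          of "\<lambda>x. x \<bullet> surface_normal \<phi> (\<gamma> s)"]
      unfolding \<alpha> normal_part[OF \<phi>] by (rule sym)
    finally show ?thesis .
  qed
  moreover have "- c\<^sup>2 \<noteq> 0" "- c\<^sup>2 \<noteq> 1"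
    using assms(4) zero_le_power2[of c] by (simp, linarith)
  \<comment> \<open>The witness is \<open>- c\<^sup>2\<close> because \<open>c\<^sup>2\<close> equals 1 when \<open>c = -1\<close>; only the square
    \<open>c ^ 4\<close> of the witness enters the claim.\<close>
  ultimately show ?thesis
    unfolding homothetic_invariant_on_def \<gamma>_def by (intro exI[of _ "- c\<^sup>2"]) auto
qed

end
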